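(* Let $K\subset\mathbb{C}$ be a convex domain with boundary $\Gamma=\partial K$ of length $a$, let $\alpha_{\pm}$ be its tangent angle functions with respect to arc length, let $\alpha:=(\alpha_++\alpha_-)/2$, and let $\kappa>0$ be a constant. Assume that one of the following (equivalent) conditions holds: (i) the almost everywhere existing curvature of $\Gamma$ satisfies $\kappa(t)=\alpha'(t)\ge\kappa$ for almost every $t\in[0,a]$; (ii) the radius of curvature $\rho(t)=1/\kappa(t)$ satisfies $\rho(t)\le 1/\kappa$ for almost every $t\in[0,a]$; (iii) $\alpha_{\pm}(y)-\alpha_{\pm}(x)\ge\kappa\,(y-x)$ for all $x,y\in[0,a]$ with $x\le y$; (iv) (subdifferential condition) $|\alpha_{\pm}(\eta)-\alpha_{\pm}(\zeta)|\ge\kappa\,|\Gamma(\eta,\zeta)|$ for all $\zeta,\eta\in\Gamma$. Then for every positive integer $n$ and every $p\in\mathcal{P}_n(K)$, $$\|p'\|\ \ge\ \frac{\kappa}{2}\,n\,\|p\| .$$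
   Context: A convex domain is a compact, convex subset of $\mathbb{C}\cong\mathbb{R}^2$ with nonempty interior. For a polynomial $q$ with complex coefficients, $\|q\|:=\max_{z\in K}|q(z)|$. For a positive integer $n$, $\mathcal{P}_n(K)$ denotes the set of complex polynomials of degree exactly $n$ all of whose $n$ complex zeros lie in $K$. Tangent angle functions: let $\gamma:[0,a]\to\mathbb{C}$ be the positively oriented arc-length parametrization of the closed Jordan curve $\Gamma=\partial K$ (extended $a$-periodically to $\mathbb{R}$). At each boundary point $\gamma(s)$, $\alpha_-(s)$ and $\alpha_+(s)$ are the arguments of the left and right half-tangent directions of $\gamma$ at $s$ (limits of the arguments of the oriented chords of $\Gamma$ approaching $\gamma(s)$ from smaller, respectively from larger, parameter values), with the branch of the argument chosen so that $\alpha_-\le\alpha_+$, the lines $\gamma(s)+e^{i\beta}\mathbb{R}$ with $\alpha_-(s)\le\beta\le\alpha_+(s)$ are exactly the supporting lines of $K$ at $\gamma(s)$, and $\alpha_\pm$ are nondecreasing functions with $\alpha_\pm(s+a)=\alpha_\pm(s)+2\pi$. The functions $\alpha_-$ and $\alpha_+$ are respectively the left- and right-continuous versions of the same nondecreasing function, and coincide except at countably many points per period. Being monotone, $\alpha$ is differentiable almost everywhere; the curvature is $\kappa(s):=\alpha'(s)$ wherever this derivative exists, and the radius of curvature is $\rho(s):=1/\kappa(s)$. In (iv), for $\zeta=\gamma(s)$ and $\eta=\gamma(t)$ with $s,t\in[0,a]$, $\alpha_\pm(\zeta)$ and $\alpha_\pm(\eta)$ mean $\alpha_\pm(s)$ and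 $\alpha_\pm(t)$, and $|\Gamma(\eta,\zeta)|=|t-s|$ is the length of the corresponding arc of $\Gamma$ between the two points. A condition written with $\alpha_\pm$ is required for both $\alpha_+$ and $\alpha_-$. *)

theory Defs
  imports
    "HOL-Complex_Analysis.Complex_Analysis"
    "HOL-Computational_Algebra.Polynomial"
begin

definition convex_domain :: "complex set \<Rightarrow> bool" where
  "convex_domain K \<longleftrightarrow> compact K \<and> convex K \<and> interior K \<noteq> {}"

(* For nonempty compact K the supremum is attained, so this is the maximum of |q| on K. *)
definition max_norm :: "complex set \<Rightarrow> complex poly \<Rightarrow> real" where
  "max_norm K q = (SUP z\<in>K. cmod (poly q z))"

(* Meant for n > 0; over the complex field a polynomial of degree n has exactly n zeros with
   multiplicity, so it is enough to require that every zero lies in K. *)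
definition polys_with_zeros_in :: "nat \<Rightarrow> complex set \<Rightarrow> complex poly set" where
  "polys_with_zeros_in n K = {q. degree q = n \<and> (\<forall>z. poly q z = 0 \<longrightarrow> z \<in> K)}"

(* Length of the curve g over [s, t]: supremum of the lengths of the inscribed polygons. *)
definition curve_length :: "(real \<Rightarrow> complex) \<Rightarrow> real \<Rightarrow> real \<Rightarrow> ereal" where
  "curve_length g s t =
     (SUP xs \<in> {xs. sorted xs \<and> set xs \<subseteq> {s..t}}.
        ereal (\<Sum>i < length xs - 1. dist (g (xs ! i)) (g (xs ! Suc i))))"

(* g is the a-periodic extension of a positively oriented arc-length parametrization of the
   boundary of K. The rescaling to [0, 1] is the library's convention for paths. *)
definition arc_length_parametrization ::
    "complex set \<Rightarrow> real \<Rightarrow> (real \<Rightarrow> complex) \<Rightarrow> bool" where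
  "arc_length_parametrization K a g \<longleftrightarrow>
     0 < a \<and>
     simple_path (\<lambda>x. g (a * x)) \<and>
     g ` {0..a} = frontier K \<and>
     (\<forall>s. g (s + a) = g s) \<and>
     (\<forall>s t. s \<le> t \<longrightarrow> curve_length g s t = ereal (t - s)) \<and>
     (\<forall>z\<in>interior K. winding_number (\<lambda>x. g (a * x)) z = 1)"

(* In the complex plane, regarded as a two-dimensional real inner product space, the set
   {w. u \<bullet> w = d} with u \<noteq> 0 is a general line. *)
definition supporting_line :: "complex set \<Rightarrow> complex \<Rightarrow> complex set \<Rightarrow> bool" where
  "supporting_line K z L \<longleftrightarrow>
     (\<exists>u d. u \<noteq> 0 \<and> L = {w. u \<bullet> w = d} \<and> z \<in> L \<and> (\<forall>w\<in>K. u \<bullet> w \<le> d))"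

(* am and ap are the left and right tangent angle functions of the boundary curve g.
   The first two conjuncts say that cis (am s) and cis (ap s) are the half-tangent directions,
   as limits of the directions of oriented chords. The remaining ones fix the branch of the
   argument (up to a global multiple of 2 * pi) and record the usual normalization: am and ap
   are the left- and right-continuous versions of one nondecreasing function. *)
definition tangent_angle_functions ::
    "complex set \<Rightarrow> real \<Rightarrow> (real \<Rightarrow> complex) \<Rightarrow> (real \<Rightarrow> real) \<Rightarrow> (real \<Rightarrow> real) \<Rightarrow> bool" where
  "tangent_angle_functions K a g am ap \<longleftrightarrow>
     (\<forall>s. ((\<lambda>t. sgn (g s - g t)) \<longlongrightarrow> cis (am s)) (at_left s)) \<and>
     (\<forall>s. ((\<lambda>t. sgn (g t - g s)) \<longlongrightarrow> cis (ap s)) (at_right s)) \<and>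
     (\<forall>s. am s \<le> ap s) \<and>
     (\<forall>s L. supporting_line K (g s) L \<longleftrightarrow>
        (\<exists>\<beta>\<in>{am s..ap s}. L = {g s + of_real r * cis \<beta> | r. True})) \<and>
     mono am \<and> mono ap \<and>
     (\<forall>s. am (s + a) = am s + 2 * pi) \<and>
     (\<forall>s. ap (s + a) = ap s + 2 * pi) \<and>
     (\<exists>f. mono f \<and> (\<forall>s. (f \<longlongrightarrow> am s) (at_left s) \<and> (f \<longlongrightarrow> ap s) (at_right s)))"

definition tangent_angle :: "(real \<Rightarrow> real) \<Rightarrow> (real \<Rightarrow> real) \<Rightarrow> real \<Rightarrow> real" where
  "tangent_angle am ap s = (ap s + am s) / 2"

(* Meaningful only where the tangent angle is differentiable. *)
definition curvature :: "(real \<Rightarrow> real) \<Rightarrow> (real \<Rightarrow> real) \<Rightarrow> real \<Rightarrow> real" where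
  "curvature am ap t = deriv (tangent_angle am ap) t"

(* Extended real: the radius of curvature is infinite (and not 0) where the curvature vanishes. *)
definition radius_of_curvature :: "(real \<Rightarrow> real) \<Rightarrow> (real \<Rightarrow> real) \<Rightarrow> real \<Rightarrow> ereal" where
  "radius_of_curvature am ap t = 1 / ereal (curvature am ap t)"

end

(* Let R = 1 / kappa. Each of the four conditions says that the tangent angle grows at rate at
   least 1 / R along the boundary, so the arc length increases by at most R times the tangent
   angle. Comparing the boundary, started at a boundary point z, with the circle of radius R
   tangent to it at z shows that K lies in the disc of this circle (Blaschke's rolling theorem).
   Take z on the frontier with |p z| maximal, and let nu be the unit normal at z pointing into
   this disc. For every zero x in the disc, Re (- nu / (z - x)) >= 1 / (2 R); summing over
   the zeros gives |p' z / p z| >= n / (2 R), as in Turan's theorem for the disc. *)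

theory Submission
  imports Defs "HOL-Computational_Algebra.Fundamental_Theorem_Algebra"
begin

section \<open>Growth and monotonicity of real functions\<close>

text \<open>A monotone function may have a singular part, so only this inequality holds; it follows
  from Fatou's lemma applied to the difference quotients.\<close>

lemma mono_growth_of_AE_deriv:
  fixes f :: "real \<Rightarrow> real"
  assumes f: "mono f" and "x \<le> y" "0 \<le> k"
    and ae: "AE t\<in>{x..y} in lebesgue. f differentiable (at t) \<and> k \<le> deriv f t"
  shows "k * (y - x) \<le> f y - f x"
proof -
  \<comment> \<open>Stopping at \<open>c < y\<close> leaves room for the forward difference
    quotients: with the steps \<open>h n\<close> below, \<open>t + h n\<close> stays within
    \<open>{x..y}\<close> for all \<open>t\<close> in \<open>{x..c}\<close>. The endpoint is
    recovered at the end by letting \<open>c\<close> tend to \<open>y\<close>.\<close>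
  have *: "k * (c - x) \<le> f y - f x" if c: "x \<le> c" "c < y" for c
  proof -
    define h where "h n = (y - c) / real (Suc n)" for n
    have h: "0 < h n" "c + h n \<le> y" for n
    proof -
      have "(y - c) / real (Suc n) \<le> (y - c) / 1"
        using c by (intro divide_left_mono) auto
      then show "0 < h n" "c + h n \<le> y" using c by (auto simp: h_def)
    qed
    have h0: "h \<longlonglongrightarrow> 0"
      unfolding h_def by (rule LIMSEQ_Suc[OF lim_const_over_n])
    define D where "D n t = (f (t + h n) - f t) / h n" for n t
    have D0: "0 \<le> D n t" for n t
      using h(1)[of n] f by (auto simp: D_def mono_def intro!: divide_nonneg_pos)
    have Dm: "D n \<in> borel_measurable borel" for n
    proof -
      have "mono (\<lambda>t. f (t + h n))" using f by (auto simp: mono_def)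
      then show ?thesis
        unfolding D_def using f
        by (intro borel_measurable_divide borel_measurable_diff borel_measurable_const borel_measurable_mono)
    qed
    have int: "f integrable_on {u..v}" for u v
      using f by (intro integrable_on_mono_on) (auto simp: mono_def mono_on_def)
    have Dint: "(D n has_integral integral {x..c} (D n)) {x..c}"
      and Dle: "integral {x..c} (D n) \<le> f y - f x" for n
    proof -
      have sh: "(\<lambda>t. f (t + h n)) integrable_on {x..c}"
           "integral {x..c} (\<lambda>t. f (t + h n)) = integral {x + h n..c + h n} f"
        using has_integral_shift_real_ivl[OF integrable_integral[OF int[of "x + h n" "c + h n"]], of "h n"]
        by (auto simp: integral_unique integrable_on_def)
      show "(D n has_integral integral {x..c} (D n)) {x..c}"
        unfolding D_def using sh(1) int[of x c]
        by (intro integrable_integral integrable_on_divide integrable_diff) auto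
      have e: "integral {x..c} (D n) = (integral {x + h n..c + h n} f - integral {x..c} f) / h n"
        unfolding D_def using sh int[of x c] by (simp add: integral_diff)
      \<comment> \<open>Splitting \<open>{x..c + h n}\<close> at \<open>c\<close> and at
        \<open>x + h n\<close> cancels the common part, so only two integrals over intervals of
        length \<open>h n\<close> remain. Monotonicity bounds them by \<open>h n * f y\<close> and
        \<open>h n * f x\<close>.\<close>
      have "integral {x..c} f + integral {c..c + h n} f = integral {x..x + h n} f + integral {x + h n..c + h n} f"
        using Henstock_Kurzweil_Integration.integral_combine[of x c "c + h n" f]
          Henstock_Kurzweil_Integration.integral_combine[of x "x + h n" "c + h n" f] h(1)[of n] c int
        by simp
      then have e2: "integral {x + h n..c + h n} f - integral {x..c} f = integral {c..c + h n} f - integral {x..x + h n} f"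
        by simp
      have "integral {c..c + h n} f \<le> integral {c..c + h n} (\<lambda>_. f y)"
        using h[of n] f by (intro integral_le int) (auto simp: mono_def)
      moreover have "integral {x..x + h n} (\<lambda>_. f x) \<le> integral {x..x + h n} f"
        using h[of n] f by (intro integral_le int) (auto simp: mono_def)
      ultimately have "integral {c..c + h n} f - integral {x..x + h n} f \<le> h n * (f y - f x)"
        using h[of n] by (simp add: algebra_simps)
      then show "integral {x..c} (D n) \<le> f y - f x"
        using h[of n] unfolding e e2 by (simp add: field_simps)
    qed
    have "ennreal (k * (c - x)) = (\<integral>\<^sup>+t. ennreal k * indicator {x..c} t \<partial>lebesgue)"
      using nn_integral_cmult_indicator[of "{x..c}" lebesgue "ennreal k"] c \<open>0 \<le> k\<close>
      by (simp add: ennreal_mult)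
    also have "\<dots> \<le> (\<integral>\<^sup>+t. liminf (\<lambda>n. ennreal (D n t) * indicator {x..c} t) \<partial>lebesgue)"
    proof (rule nn_integral_mono_AE, rule AE_mp[OF ae], rule AE_I2, rule impI)
      fix t assume t: "t \<in> {x..y} \<longrightarrow> f differentiable at t \<and> k \<le> deriv f t"
      show "ennreal k * indicator {x..c} t \<le> liminf (\<lambda>n. ennreal (D n t) * indicator {x..c} t)"
      proof (cases "t \<in> {x..c}")
        case True
        then have "(f has_real_derivative deriv f t) (at t)" and k: "k \<le> deriv f t"
          using t c by (auto simp: DERIV_deriv_iff_real_differentiable)
        then have lim: "((\<lambda>d. (f (t + d) - f t) / d) \<longlongrightarrow> deriv f t) (at 0)"
          by (simp add: DERIV_def)
        have "filterlim h (at 0) sequentially"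
          using h0 h(1) by (auto simp: filterlim_at less_imp_neq[OF h(1), symmetric])
        from filterlim_compose[OF lim this] have "(\<lambda>n. D n t) \<longlonglongrightarrow> deriv f t"
          by (simp add: D_def)
        then have "(\<lambda>n. ennreal (D n t)) \<longlonglongrightarrow> ennreal (deriv f t)"
          by (rule tendsto_ennrealI)
        then have "liminf (\<lambda>n. ennreal (D n t)) = ennreal (deriv f t)"
          by (intro lim_imp_Liminf) auto
        then show ?thesis using True k by (simp add: ennreal_leI)
      qed auto
    qed
    also have "\<dots> \<le> liminf (\<lambda>n. \<integral>\<^sup>+t. ennreal (D n t) * indicator {x..c} t \<partial>lebesgue)"
      using Dm by (intro nn_integral_liminf) (auto intro!: borel_measurable_times_ennreal measurable_completion)
    also have "\<dots> \<le> ennreal (f y - f x)"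
    proof -
      have "(\<integral>\<^sup>+t. ennreal (D n t) * indicator {x..c} t \<partial>lebesgue) \<le> ennreal (f y - f x)" for n
      proof -
        have "(\<integral>\<^sup>+t. ennreal (D n t) * indicator {x..c} t \<partial>lebesgue)
            = (\<integral>\<^sup>+t. ennreal (D n t) * indicator {x..c} t \<partial>lborel)"
          by (rule nn_integral_completion)
        also have "\<dots> = ennreal (integral {x..c} (D n))"
          by (intro nn_integral_has_integral_lebesgue' D0 Dint)
        finally show ?thesis using Dle by (simp add: ennreal_leI)
      qed
      then show ?thesis by (intro Liminf_le) auto
    qed
    finally show ?thesis
      using f \<open>x \<le> y\<close> by (simp add: ennreal_le_iff mono_def)
  qed
  show ?thesis
  proof (cases "x = y")
    case False
    have "((\<lambda>c. k * (c - x)) \<longlongrightarrow> k * (y - x)) (at_left y)"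
      by (intro tendsto_intros)
    moreover have "eventually (\<lambda>c. k * (c - x) \<le> f y - f x) (at_left y)"
      using eventually_at_left_real[of x y] False \<open>x \<le> y\<close> by (auto elim!: eventually_mono intro: *)
    ultimately show ?thesis by (rule tendsto_upperbound) auto
  qed auto
qed

text \<open>Continuation argument with slope error \<open>e\<close>: the left condition puts the
  supremum of the points reached into the set reached, and the right condition moves past it unless
  it is \<open>v\<close>. No derivative or continuity is required, so \<open>F\<close> may jump
  upwards, as it does at corners of the boundary.\<close>

lemma le_if_right_nondecreasing:
  fixes F :: "real \<Rightarrow> real"
  assumes "u \<le> v"
    and right: "\<And>s e. u \<le> s \<Longrightarrow> s < v \<Longrightarrow> 0 < e \<Longrightarrow> eventually (\<lambda>t. F s - e * (t - s) \<le> F t) (at_right s)"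
    and left: "\<And>s e. u < s \<Longrightarrow> s \<le> v \<Longrightarrow> 0 < e \<Longrightarrow> eventually (\<lambda>t. F t \<le> F s + e) (at_left s)"
  shows "F u \<le> F v"
proof -
  have *: "F u - e * (v - u) \<le> F v" if e: "0 < e" for e
  proof -
    define A where "A = {t \<in> {u..v}. F u - e * (t - u) \<le> F t}"
    define c where "c = Sup A"
    have uA: "u \<in> A" and bd: "bdd_above A"
      using \<open>u \<le> v\<close> by (auto simp: A_def intro: bdd_aboveI[of _ v])
    have c: "u \<le> c" "c \<le> v"
      using uA bd by (auto simp: c_def A_def intro!: cSup_upper cSup_least)
    have cA: "c \<in> A"
    proof (rule ccontr)
      assume n: "c \<notin> A"
      then have uc: "u < c" using uA c by (cases "u = c") auto
      have "F u - e * (c - u) \<le> F c + d" if d: "0 < d" for d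
      proof -
        from left[OF uc c(2) d] obtain b where b: "b < c" "\<And>t. b < t \<Longrightarrow> t < c \<Longrightarrow> F t \<le> F c + d"
          using uc by (auto simp: eventually_at_left[OF uc])
        obtain t where t: "t \<in> A" "b < t"
          using b(1) less_cSup_iff[OF _ bd, of b] uA unfolding c_def by auto
        have "t \<le> c" using t(1) bd unfolding c_def by (rule cSup_upper)
        then have tc: "t < c" using n t(1) by (cases "t = c") auto
        then have "e * (t - u) \<le> e * (c - u)" using e by (simp add: mult_left_mono)
        moreover have "F t \<le> F c + d" using b t tc by auto
        ultimately show ?thesis using t(1) by (auto simp: A_def)
      qed
      then have "F u - e * (c - u) \<le> F c" by (rule field_le_epsilon)
      then show False using n c by (auto simp: A_def)
    qed
    have "c = v"
    proof (rule ccontr)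
      assume "c \<noteq> v"
      then have cv: "c < v" using c by simp
      from right[OF c(1) cv e] obtain b where b: "b > c" "\<And>t. c < t \<Longrightarrow> t < b \<Longrightarrow> F c - e * (t - c) \<le> F t"
        by (auto simp: eventually_at_right[OF cv])
      define t where "t = (c + min b v) / 2"
      have t: "c < t" "t < b" "t < v" using b cv by (auto simp: t_def)
      have "F c - e * (t - c) \<le> F t" using b t by auto
      then have "t \<in> A" using cA t by (auto simp: A_def algebra_simps)
      then have "t \<le> c" unfolding c_def using bd by (rule cSup_upper)
      then show False using t by simp
    qed
    then show ?thesis using cA by (auto simp: A_def)
  qed
  have "F u \<le> F v + d" if "0 < d" for d
  proof -
    \<comment> \<open>The summand 1 keeps the denominator positive when
      \<open>u = v\<close>.\<close>
    have "d / (v - u + 1) * (v - u) \<le> d" using that \<open>u \<le> v\<close> by (simp add: field_simps)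
    then show ?thesis using *[of "d / (v - u + 1)"] that \<open>u \<le> v\<close> by auto
  qed
  then show ?thesis by (rule field_le_epsilon)
qed

section \<open>Logarithmic derivatives of polynomials\<close>

text \<open>The logarithmic derivative of \<open>p\<close> at \<open>z\<close> is the sum of
  \<open>1 / (z - x)\<close> over the zeros \<open>x\<close> with multiplicity. The induction splits
  off one linear factor at a time.\<close>

lemma poly_logderiv_ge:
  fixes p :: "complex poly"
  assumes "\<And>x. poly p x = 0 \<Longrightarrow> m \<le> Re (u / (z - x))" and "poly p z \<noteq> 0"
  shows "real (degree p) * m \<le> Re (u * poly (pderiv p) z / poly p z)"
  using assms
proof (induction "degree p" arbitrary: p)
  case 0
  then have "pderiv p = 0" by (simp add: pderiv_eq_0_iff)
  then show ?case using 0 by (metis Re_divide_of_nat div_0 mult_zero_right mult_zero_left of_nat_0 order_refl poly_0 zero_complex.simps(1))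
next
  case (Suc n)
  then obtain x where x: "poly p x = 0" using alg_closed_imp_poly_has_root[of p] by auto
  then obtain q where q: "p = [:-x, 1:] * q" by (auto simp: poly_eq_0_iff_dvd)
  have nz: "z - x \<noteq> 0" "poly q z \<noteq> 0" using Suc.prems(2) by (auto simp: q)
  then have "q \<noteq> 0" by auto
  then have dp: "degree p = Suc (degree q)" unfolding q by (subst degree_mult_eq) auto
  have "real (degree q) * m \<le> Re (u * poly (pderiv q) z / poly q z)"
    using Suc.prems nz dp Suc.hyps(2) by (intro Suc.hyps(1)) (auto simp: q)
  moreover have "poly (pderiv p) z = (z - x) * poly (pderiv q) z + poly q z"
      and "poly p z = (z - x) * poly q z"
    unfolding q pderiv_mult by (auto simp: pderiv_pCons algebra_simps)
  then have "u * poly (pderiv p) z / poly p z = u / (z - x) + u * poly (pderiv q) z / poly q z"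
    using nz by (simp add: add_divide_distrib distrib_left)
  ultimately show ?case using Suc.prems(1)[OF x] dp by (simp add: algebra_simps)
qed

section \<open>Comparing a boundary curve with a circle\<close>

lemma inner_ii_cis_cis: "(\<i> * cis \<theta>) \<bullet> cis \<phi> = sin (\<phi> - \<theta>)"
  by (simp add: inner_complex_def sin_diff)

lemma abs_sin_diff_le:
  fixes x y :: real
  shows "\<bar>sin x - sin y\<bar> \<le> \<bar>x - y\<bar>"
proof -
  have "\<bar>sin x - sin y\<bar> = 2 * \<bar>sin ((x - y) / 2)\<bar> * \<bar>cos ((x + y) / 2)\<bar>"
    by (simp add: sin_diff_sin abs_mult)
  also have "\<dots> \<le> 2 * \<bar>sin ((x - y) / 2)\<bar> * 1"
    by (intro mult_left_mono) auto
  also have "\<dots> \<le> \<bar>x - y\<bar>"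
    using abs_sin_x_le_abs_x[of "(x - y) / 2"] by simp
  finally show ?thesis .
qed

text \<open>Collects what the comparison uses; \<open>R\<close> is the reciprocal of the curvature
  bound. Arc length enters only through \<open>lipschitz\<close>. The bound \<open>growth\<close> is
  local and one-sided because the comparison proceeds by continuation to the right, which also
  passes over the ends of a period.\<close>

locale curved_boundary =
  fixes g :: "real \<Rightarrow> complex" and a R :: real and am ap :: "real \<Rightarrow> real"
  assumes R_pos: "0 < R" and a_pos: "0 < a"
    and lipschitz: "\<And>s t. s \<le> t \<Longrightarrow> cmod (g t - g s) \<le> t - s"
    and periodic: "\<And>s. g (s + a) = g s" "\<And>s. ap (s + a) = ap s + 2 * pi"
    and left_tangent: "\<And>s. ((\<lambda>t. sgn (g s - g t)) \<longlongrightarrow> cis (am s)) (at_left s)"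
    and right_tangent: "\<And>s. ((\<lambda>t. sgn (g t - g s)) \<longlongrightarrow> cis (ap s)) (at_right s)"
    and am_le_ap: "\<And>s. am s \<le> ap s"
    and ap_le_am: "\<And>s t. s < t \<Longrightarrow> ap s \<le> am t"
    and ap_right_cont: "\<And>s. (ap \<longlongrightarrow> ap s) (at_right s)"
    and growth: "\<And>s. eventually (\<lambda>t. t - s \<le> R * (ap t - ap s)) (at_right s)"
begin

lemma ap_mono: "s \<le> t \<Longrightarrow> ap s \<le> ap t"
  using ap_le_am[of s t] am_le_ap[of t] by (cases "s = t") auto

lemma inner_lipschitz:
  assumes "s \<le> t" "norm u = 1"
  shows "\<bar>u \<bullet> g t - u \<bullet> g s\<bar> \<le> t - s"
proof -
  have "\<bar>u \<bullet> (g t - g s)\<bar> \<le> norm u * norm (g t - g s)" by (rule Cauchy_Schwarz_ineq2)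
  then show ?thesis using lipschitz[OF assms(1)] assms(2) by (simp add: inner_diff_right)
qed

lemma inner_near_left:
  assumes "norm u = 1" "0 < e"
  shows "eventually (\<lambda>t. \<bar>u \<bullet> g s - u \<bullet> g t\<bar> \<le> e) (at_left s)"
proof -
  have "eventually (\<lambda>t. t \<in> {s - e<..<s}) (at_left s)"
    using assms by (intro eventually_at_left_real) auto
  then show ?thesis
  proof eventually_elim
    case (elim t)
    then show ?case using inner_lipschitz[of t s u] assms by auto
  qed
qed

lemma continuous_inner: "norm u = 1 \<Longrightarrow> continuous_on UNIV (\<lambda>t. u \<bullet> g t)"
  by (rule lipschitz_on_continuous_on[where L = 1], rule lipschitz_onI)
     (metis abs_minus_commute dist_real_def inner_lipschitz linear mult_1 abs_of_nonneg diff_ge_0_iff_ge, simp)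

text \<open>The right tangent controls the increment relative to the chord length, which is at most
  \<open>t - s\<close>. Since \<open>k \<le> 0\<close> makes the factor \<open>k - e\<close>
  negative, the lower bound survives replacing the chord length by \<open>t - s\<close>.\<close>

lemma inner_increment_right:
  assumes u: "norm u = 1" and k: "k \<le> 0" "k \<le> u \<bullet> cis (ap s)" and e: "0 < e"
  shows "eventually (\<lambda>t. (k - e) * (t - s) \<le> u \<bullet> g t - u \<bullet> g s) (at_right s)"
proof -
  have "((\<lambda>t. u \<bullet> sgn (g t - g s)) \<longlongrightarrow> u \<bullet> cis (ap s)) (at_right s)"
    by (intro tendsto_intros right_tangent)
  then have "eventually (\<lambda>t. u \<bullet> sgn (g t - g s) > k - e) (at_right s)"
    using k e by (intro order_tendstoD) auto
  moreover have "eventually (\<lambda>t. s < t) (at_right s)" by (rule eventually_at_right_less)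
  ultimately show ?thesis
  proof eventually_elim
    case (elim t)
    have "(k - e) * (t - s) \<le> (k - e) * norm (g t - g s)"
      using lipschitz[of s t] elim k e by (intro mult_left_mono_neg) auto
    also have "\<dots> \<le> (u \<bullet> sgn (g t - g s)) * norm (g t - g s)"
      using elim by (intro mult_right_mono) auto
    also have "\<dots> = u \<bullet> g t - u \<bullet> g s"
      \<comment> \<open>With \<open>sgn 0 = 0\<close>, the identity also holds for a vanishing
        chord.\<close>
      by (cases "g t = g s") (auto simp: sgn_div_norm inner_diff_right field_simps)
    finally show ?case .
  qed
qed

text \<open>Continuation with \<open>k = 0\<close> in the increment bound: a curve whose right
  tangents never point against \<open>n\<close> does not descend in direction
  \<open>n\<close>.\<close>

lemma inner_le_if_tangent_nonneg:
  assumes "u \<le> v" "norm n = 1" "\<And>x. u \<le> x \<Longrightarrow> x < v \<Longrightarrow> 0 \<le> n \<bullet> cis (ap x)"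
  shows "n \<bullet> g u \<le> n \<bullet> g v"
proof (rule le_if_right_nondecreasing[OF \<open>u \<le> v\<close>])
  fix s e :: real assume "u \<le> s" "s < v" and e: "0 < e"
  then show "eventually (\<lambda>t. n \<bullet> g s - e * (t - s) \<le> n \<bullet> g t) (at_right s)"
    using inner_increment_right[of n 0 s e] assms by (simp add: algebra_simps)
next
  fix s e :: real assume "0 < e"
  from inner_near_left[OF assms(2) this, of s]
  show "eventually (\<lambda>t. n \<bullet> g t \<le> n \<bullet> g s + e) (at_left s)"
    by (auto elim!: eventually_mono)
qed

lemma norm_ii_cis: "norm (\<i> * cis \<theta>) = 1"
  by (simp add: norm_mult)

text \<open>The unit vector \<^term>\<open>\<i> * cis \<theta>\<close> is the inner normal at a point with tangent angle \<^term>\<open>\<theta>\<close>.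
  The quantity below is constant along a circle of radius \<^term>\<open>R\<close>.\<close>

lemma comparison_mono:
  assumes "u \<le> v" and win: "\<theta> - pi \<le> ap u" "ap v \<le> \<theta>"
  shows "R * cos (\<theta> - ap u) + (\<i> * cis \<theta>) \<bullet> g u \<le> R * cos (\<theta> - ap v) + (\<i> * cis \<theta>) \<bullet> g v"
proof (rule le_if_right_nondecreasing[OF \<open>u \<le> v\<close>])
  fix s e :: real assume s: "u \<le> s" "s < v" and e: "0 < e"
  \<comment> \<open>Minus the component of the right tangent at \<open>s\<close> along the normal
    \<open>\<i> * cis \<theta>\<close>. To first order the inner product changes by at least
    \<open>- k * (t - s)\<close> and the cosine term by at least \<open>k * (t - s)\<close>; these
    cancel, and each contributes an error of \<open>e / 2\<close> per unit of
    \<open>t - s\<close>.\<close>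
  define k where "k = sin (\<theta> - ap s)"
  have aps: "\<theta> - pi \<le> ap s" "ap s \<le> \<theta>" using ap_mono[of u s] ap_mono[of s v] s win by auto
  have k: "0 \<le> k" unfolding k_def using aps by (intro sin_ge_zero) auto
  have "eventually (\<lambda>t. (- k - e / 2) * (t - s) \<le> (\<i> * cis \<theta>) \<bullet> g t - (\<i> * cis \<theta>) \<bullet> g s) (at_right s)"
    using k e by (intro inner_increment_right norm_ii_cis)
      (auto simp: inner_ii_cis_cis k_def sin_diff)
  moreover have "eventually (\<lambda>t. ap t < ap s + e / 2) (at_right s)"
    using e by (intro order_tendstoD[OF ap_right_cont]) auto
  moreover have "eventually (\<lambda>t. t \<in> {s<..<v}) (at_right s)"
    using s by (intro eventually_at_right_real)
  ultimately show "eventually (\<lambda>t. R * cos (\<theta> - ap s) + (\<i> * cis \<theta>) \<bullet> g s - e * (t - s)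
      \<le> R * cos (\<theta> - ap t) + (\<i> * cis \<theta>) \<bullet> g t) (at_right s)"
    using growth[of s]
  proof eventually_elim
    case (elim t)
    have "0 < R * (ap t - ap s)" using elim by auto
    then have apt: "ap s < ap t" "ap t \<le> \<theta>"
      using elim win ap_mono[of t v] R_pos by (auto simp: zero_less_mult_iff)
    \<comment> \<open>The mean value theorem is applied in the angle variable, so \<open>ap\<close>
      need not be differentiable. Because the sine at \<open>z\<close> is nonnegative,
      \<open>growth\<close> can then replace the angle increment by the parameter increment.\<close>
    have "\<exists>z>ap s. z < ap t \<and> cos (\<theta> - ap t) - cos (\<theta> - ap s) = (ap t - ap s) * sin (\<theta> - z)"
      using apt by (intro MVT2) (auto intro!: derivative_eq_intros)
    then obtain z where z: "ap s < z" "z < ap t"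
      "cos (\<theta> - ap t) - cos (\<theta> - ap s) = (ap t - ap s) * sin (\<theta> - z)" by blast
    have sz: "0 \<le> sin (\<theta> - z)" using z apt aps by (intro sin_ge_zero) auto
    have kz: "k - e / 2 \<le> sin (\<theta> - z)"
      using abs_sin_diff_le[of "\<theta> - ap s" "\<theta> - z"] z elim unfolding k_def by linarith
    have "(k - e / 2) * (t - s) \<le> sin (\<theta> - z) * (t - s)"
      using kz elim by (intro mult_right_mono) auto
    also have "\<dots> \<le> sin (\<theta> - z) * (R * (ap t - ap s))"
      using sz elim by (intro mult_left_mono) auto
    also have "\<dots> = R * (cos (\<theta> - ap t) - cos (\<theta> - ap s))"
      unfolding z(3) by simp
    finally have "(k - e / 2) * (t - s) \<le> R * cos (\<theta> - ap t) - R * cos (\<theta> - ap s)"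
      by (simp add: right_diff_distrib)
    moreover have "(k - e / 2) * (t - s) + (- k - e / 2) * (t - s) = - (e * (t - s))"
      by (simp add: field_simps)
    ultimately show ?case using elim(1) by linarith
  qed
next
  fix s e :: real assume s: "u < s" "s \<le> v" and e: "0 < e"
  have "eventually (\<lambda>t. t \<in> {u<..<s}) (at_left s)"
    using s by (intro eventually_at_left_real)
  with inner_near_left[OF norm_ii_cis e, of \<theta> s]
  show "eventually (\<lambda>t. R * cos (\<theta> - ap t) + (\<i> * cis \<theta>) \<bullet> g t
      \<le> R * cos (\<theta> - ap s) + (\<i> * cis \<theta>) \<bullet> g s + e) (at_left s)"
  proof eventually_elim
    case (elim t)
    \<comment> \<open>\<open>ap\<close> may jump at \<open>s\<close>, but within the half turn below
      \<open>\<theta>\<close> this only raises the cosine term.\<close>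
    have "cos (\<theta> - ap t) \<le> cos (\<theta> - ap s)"
      using ap_mono[of u t] ap_mono[of t s] ap_mono[of s v] elim s win
      by (intro cos_monotone_0_pi_le) auto
    then have "R * cos (\<theta> - ap t) \<le> R * cos (\<theta> - ap s)" using R_pos by simp
    then show ?case using elim by linarith
  qed
qed

lemma tendsto_inner_at_left:
  "norm u = 1 \<Longrightarrow> ((\<lambda>t. u \<bullet> g t) \<longlongrightarrow> u \<bullet> g s) (at_left s)"
  using continuous_inner[of u] by (meson UNIV_I continuous_on_def tendsto_within_subset top_greatest)

text \<open>Comparison is possible only while the tangent angle stays within \<^term>\<open>pi\<close> of \<^term>\<open>\<theta>\<close>. Hence
  the two points are joined forwards from \<^term>\<open>s\<close> to \<^term>\<open>t\<close> if \<^term>\<open>\<theta>\<close> is in the first half turn, and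
  forwards from \<^term>\<open>t\<close> to \<^term>\<open>s + a\<close> if it is in the second one. Where the one-sided tangent at
  \<^term>\<open>t\<close> puts the tangent angle on the wrong side, monotonicity of the inner product suffices.\<close>

lemma inner_deviation_le:
  assumes t: "s < t" "t < s + a" and \<theta>: "ap s \<le> \<theta>" "\<theta> \<le> ap s + 2 * pi"
    and min: "\<And>x. (\<i> * cis \<theta>) \<bullet> g t \<le> (\<i> * cis \<theta>) \<bullet> g x"
  shows "(\<i> * cis \<theta>) \<bullet> g s - (\<i> * cis \<theta>) \<bullet> g t \<le> R * (1 - cos (\<theta> - ap s))"
proof -
  let ?n = "\<i> * cis \<theta>"
  let ?b = "ap s"
  note lim = tendsto_inner_at_left[OF norm_ii_cis[of \<theta>]]
  have ap_end: "ap x \<le> ?b + 2 * pi" if "x < s + a" for x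
    using ap_mono[of x "s + a"] periodic(2)[of s] that by simp
  have bm: "?b \<le> am t" "?b \<le> ap t" "ap t \<le> ?b + 2 * pi"
    using ap_le_am[OF t(1)] am_le_ap[of t] ap_end[OF t(2)] by auto
  have R1: "0 \<le> R * (1 - cos (\<theta> - ?b))" using R_pos by simp
  show ?thesis
  proof (cases "\<theta> \<le> ?b + pi")
    case True
    \<comment> \<open>Chords arriving at the minimum cannot ascend, so the left tangent has
      nonpositive normal component. Given the range of \<open>am t - \<theta>\<close>, either
      \<open>am t \<le> \<theta>\<close> or \<open>am t \<ge> \<theta> + pi\<close>.\<close>
    have "((\<lambda>x. ?n \<bullet> sgn (g t - g x)) \<longlongrightarrow> ?n \<bullet> cis (am t)) (at_left t)"
      by (intro tendsto_intros left_tangent)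
    moreover have "eventually (\<lambda>x. ?n \<bullet> sgn (g t - g x) \<le> 0) (at_left t)"
      using min by (auto simp: sgn_div_norm inner_diff_right divide_simps mult_le_0_iff intro!: always_eventually)
    ultimately have "sin (am t - \<theta>) \<le> 0"
      unfolding inner_ii_cis_cis by (rule tendsto_upperbound) auto
    show ?thesis
    proof (cases "am t \<le> \<theta>")
      case le: True
      \<comment> \<open>The comparison runs to \<open>x < t\<close> and then \<open>x\<close> tends
        to \<open>t\<close>: at a corner \<open>ap t\<close> may exceed \<open>\<theta>\<close>,
        whereas \<open>ap x \<le> am t \<le> \<theta>\<close>.\<close>
      have "eventually (\<lambda>x. R * cos (\<theta> - ?b) + ?n \<bullet> g s - R \<le> ?n \<bullet> g x) (at_left t)"
        using eventually_at_left_real[OF t(1)]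
      proof eventually_elim
        case (elim x)
        then have "R * cos (\<theta> - ?b) + ?n \<bullet> g s \<le> R * cos (\<theta> - ap x) + ?n \<bullet> g x"
          using True le ap_le_am[of x t] by (intro comparison_mono) auto
        moreover have "R * cos (\<theta> - ap x) \<le> R * 1" using R_pos by (intro mult_left_mono) auto
        ultimately show ?case by linarith
      qed
      with lim have "R * cos (\<theta> - ?b) + ?n \<bullet> g s - R \<le> ?n \<bullet> g t"
        by (rule tendsto_lowerbound) auto
      then show ?thesis by (simp add: algebra_simps)
    next
      case False
      have "am t - \<theta> \<ge> pi"
        using \<open>sin (am t - \<theta>) \<le> 0\<close> sin_gt_zero[of "am t - \<theta>"] False by force
      \<comment> \<open>From \<open>t\<close> to \<open>s + a\<close> the tangent angle lies between
        \<open>\<theta> + pi\<close> and \<open>\<theta> + 2 * pi\<close>, so the curve only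
        descends on its way back to \<open>g s\<close>.\<close>
      have "(- ?n) \<bullet> g t \<le> (- ?n) \<bullet> g (s + a)"
      proof (rule inner_le_if_tangent_nonneg)
        fix x assume x: "t \<le> x" "x < s + a"
        have "pi \<le> ap x - \<theta>" "ap x - \<theta> \<le> 2 * pi"
          using \<open>am t - \<theta> \<ge> pi\<close> am_le_ap[of t] ap_mono[OF x(1)] ap_end[OF x(2)] \<theta> by auto
        then have "sin (ap x - \<theta>) \<le> 0" using sin_le_zero[of "ap x - \<theta>"] by (cases "ap x - \<theta> = 2 * pi") simp_all
        then show "0 \<le> (- ?n) \<bullet> cis (ap x)" by (simp only: inner_minus_left inner_ii_cis_cis neg_0_le_iff_le)
      qed (use t norm_ii_cis in \<open>auto simp: norm_minus_cancel simp del: norm_mult\<close>)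
      then show ?thesis using R1 periodic(1)[of s] by simp
    qed
  next
    case False
    \<comment> \<open>Chords leaving the minimum cannot descend, so either
      \<open>\<theta> \<le> ap t\<close> or \<open>ap t \<le> \<theta> - pi\<close>.\<close>
    have "((\<lambda>x. ?n \<bullet> sgn (g x - g t)) \<longlongrightarrow> ?n \<bullet> cis (ap t)) (at_right t)"
      by (intro tendsto_intros right_tangent)
    moreover have "eventually (\<lambda>x. 0 \<le> ?n \<bullet> sgn (g x - g t)) (at_right t)"
      using min by (auto simp: sgn_div_norm inner_diff_right divide_simps intro!: always_eventually)
    ultimately have sinp: "0 \<le> sin (ap t - \<theta>)"
      unfolding inner_ii_cis_cis by (rule tendsto_lowerbound) auto
    show ?thesis
    proof (cases "\<theta> \<le> ap t")
      case le: True
      have "eventually (\<lambda>x. ?n \<bullet> g x \<le> ?n \<bullet> g t + R * (1 - cos (\<theta> - ?b))) (at_left (s + a))"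
        using eventually_at_left_real[OF t(2)]
      proof eventually_elim
        case (elim x)
        have "ap x \<le> \<theta> + pi" using ap_end[of x] elim False by auto
        \<comment> \<open>On the second half turn the comparison is applied to the opposite normal,
          that is, with \<open>\<theta> + pi\<close> in place of \<open>\<theta>\<close>.\<close>
        have "R * cos (\<theta> + pi - ap t) + (\<i> * cis (\<theta> + pi)) \<bullet> g t
            \<le> R * cos (\<theta> + pi - ap x) + (\<i> * cis (\<theta> + pi)) \<bullet> g x"
          using elim le \<open>ap x \<le> \<theta> + pi\<close> by (intro comparison_mono) auto
        moreover have "cos (\<theta> + pi - y) = - cos (\<theta> - y)" for y
          using cos_periodic_pi[of "\<theta> - y"] by (simp add: algebra_simps)
        moreover have "\<i> * cis (\<theta> + pi) = - ?n" by (simp add: cis_mult[symmetric])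
        ultimately have "?n \<bullet> g x \<le> ?n \<bullet> g t + R * cos (\<theta> - ap t) - R * cos (\<theta> - ap x)"
          by (simp add: inner_minus_left)
        moreover have "R * cos (\<theta> - ap t) \<le> R * 1" using R_pos by (intro mult_left_mono) auto
        moreover have "cos (\<theta> - ?b) \<le> cos (\<theta> - ap x)"
        proof -
          have "cos (?b + 2 * pi - \<theta>) \<le> cos (ap x - \<theta>)"
            using ap_end[of x] ap_mono[of t x] elim le False by (intro cos_monotone_0_pi_le) auto
          moreover have "cos (?b + 2 * pi - \<theta>) = cos (\<theta> - ?b)"
            using cos_minus[of "\<theta> - ?b"] cos_periodic[of "?b - \<theta>"] by (simp add: algebra_simps)
          moreover have "cos (ap x - \<theta>) = cos (\<theta> - ap x)"
            using cos_minus[of "\<theta> - ap x"] by simp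
          ultimately show ?thesis by simp
        qed
        then have "R * cos (\<theta> - ?b) \<le> R * cos (\<theta> - ap x)" using R_pos by simp
        ultimately show ?case by (simp add: algebra_simps)
      qed
      with lim have "?n \<bullet> g (s + a) \<le> ?n \<bullet> g t + R * (1 - cos (\<theta> - ?b))"
        by (rule tendsto_upperbound) auto
      then show ?thesis using periodic(1)[of s] by simp
    next
      case lt: False
      have "pi \<le> \<theta> - ap t"
        using sinp sin_gt_zero[of "\<theta> - ap t"] sin_minus[of "\<theta> - ap t"] lt by force
      \<comment> \<open>From \<open>s\<close> to \<open>t\<close> the tangent angle lies between
        \<open>\<theta> - 2 * pi\<close> and \<open>\<theta> - pi\<close>, where the curve only
        ascends.\<close>
      have "?n \<bullet> g s \<le> ?n \<bullet> g t"
      proof (rule inner_le_if_tangent_nonneg)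
        fix x assume x: "s \<le> x" "x < t"
        have "pi \<le> \<theta> - ap x" "\<theta> - ap x \<le> 2 * pi"
          using \<open>pi \<le> \<theta> - ap t\<close> ap_mono[of s x] ap_mono[of x t] x \<theta> by auto
        then have "sin (\<theta> - ap x) \<le> 0" using sin_le_zero[of "\<theta> - ap x"] by (cases "\<theta> - ap x = 2 * pi") simp_all
        then show "0 \<le> ?n \<bullet> cis (ap x)"
          using sin_minus[of "\<theta> - ap x"] by (simp only: inner_ii_cis_cis) simp
      qed (use t norm_ii_cis in auto)
      then show ?thesis using R1 by simp
    qed
  qed
qed

end

section \<open>The rolling disc\<close>

text \<open>From an interior point a small step against \<open>u\<close> would stay in
  \<open>K\<close> and lower the inner product.\<close>

lemma minimal_inner_in_frontier:
  fixes u :: "'a::euclidean_space"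
  assumes "m \<in> K" "u \<noteq> 0" and min: "\<And>x. x \<in> K \<Longrightarrow> u \<bullet> m \<le> u \<bullet> x"
  shows "m \<in> frontier K"
proof (rule ccontr)
  assume "m \<notin> frontier K"
  then have "m \<in> interior K" using \<open>m \<in> K\<close> closure_subset by (auto simp: frontier_def)
  then obtain e where e: "0 < e" "cball m e \<subseteq> K" by (auto simp: mem_interior_cball)
  have "m - e *\<^sub>R sgn u \<in> K"
    using e \<open>u \<noteq> 0\<close> by (intro subsetD[OF e(2)]) (auto simp: dist_norm norm_sgn)
  then have "u \<bullet> m \<le> u \<bullet> (m - e *\<^sub>R sgn u)" by (rule min)
  moreover have "u \<bullet> sgn u = norm u"
    using \<open>u \<noteq> 0\<close> by (simp add: sgn_div_norm power2_norm_eq_inner[symmetric] power2_eq_square)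
  ultimately show False using e(1) \<open>u \<noteq> 0\<close> by (simp add: inner_diff_right mult_le_0_iff)
qed

context curved_boundary
begin

lemma representative: "\<exists>t. s \<le> t \<and> t < s + a \<and> g t = g x"
proof -
  interpret periodic_fun_simple g a by standard (rule periodic(1))
  define k where "k = \<lfloor>(x - s) / a\<rfloor>"
  have "of_int k \<le> (x - s) / a" "(x - s) / a < of_int k + 1" unfolding k_def by linarith+
  then have "s \<le> x - of_int k * a" "x - of_int k * a < s + a"
    using a_pos by (auto simp: field_simps)
  then show ?thesis using minus_of_int[of x k] by (intro exI[of _ "x - of_int k * a"]) auto
qed

text \<open>For \<open>w\<close> in \<open>K\<close>, let \<open>u\<close> be the unit vector from
  \<open>w\<close> towards the centre. The minimum of \<open>u\<close> over \<open>K\<close> is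
  attained on the curve, and \<open>inner_deviation_le\<close> bounds how far it lies below the
  value at \<open>g s\<close>. Measured from the centre, this makes every value of \<open>u\<close>
  on \<open>K\<close> at least \<open>- R\<close>, while at \<open>w\<close> it is minus the
  distance from the centre.\<close>

lemma subset_rolling_disc:
  assumes K: "compact K" "frontier K = range g"
  shows "K \<subseteq> cball (g s + of_real R * (\<i> * cis (ap s))) R"
proof
  fix w assume w: "w \<in> K"
  define c where "c = g s + of_real R * (\<i> * cis (ap s))"
  define d where "d = w - c"
  have "cmod d \<le> R"
  proof (cases "d = 0")
    case False
    \<comment> \<open>Among the angles with \<open>\<i> * cis \<theta> = - sgn d\<close>, this one
      lies in the full turn starting at \<open>ap s\<close>, as \<open>inner_deviation_le\<close>
      requires.\<close>
    define \<theta> where "\<theta> = ap s + Arg2pi (\<i> * sgn d / cis (ap s))"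
    define u where "u = \<i> * cis \<theta>"
    have \<theta>: "ap s \<le> \<theta>" "\<theta> \<le> ap s + 2 * pi"
      using Arg2pi_ge_0 Arg2pi_lt_2pi by (auto simp: \<theta>_def less_imp_le)
    have "cis (Arg2pi (\<i> * sgn d / cis (ap s))) = \<i> * sgn d / cis (ap s)"
      using Arg2pi_eq[of "\<i> * sgn d / cis (ap s)"] False
      by (simp add: norm_mult norm_divide norm_sgn cis_conv_exp)
    then have u: "u = - sgn d"
      by (simp add: u_def \<theta>_def cis_mult[symmetric])
    have u1: "norm u = 1" unfolding u_def by (rule norm_ii_cis)
    have "\<exists>m\<in>K. \<forall>x\<in>K. u \<bullet> m \<le> u \<bullet> x"
      using w by (intro continuous_attains_inf K continuous_intros) auto
    then obtain m where m: "m \<in> K" "\<And>x. x \<in> K \<Longrightarrow> u \<bullet> m \<le> u \<bullet> x" by blast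
    have gK: "g x \<in> K" for x
      using K compact_imp_closed frontier_subset_closed by blast
    have "m \<in> range g" using minimal_inner_in_frontier[of m K u] m u1 K(2) by force
    then obtain t where t: "s \<le> t" "t < s + a" "g t = m" using representative by (metis imageE)
    have "u \<bullet> g s - u \<bullet> m \<le> R * (1 - cos (\<theta> - ap s))"
    proof (cases "t = s")
      case True
      then show ?thesis using R_pos t(3) by simp
    next
      case False
      then show ?thesis
        using inner_deviation_le[of s t \<theta>] t \<theta> m(2)[OF gK] by (auto simp: u_def)
    qed
    moreover have "u \<bullet> m \<le> u \<bullet> w" using m w by blast
    moreover have "u \<bullet> (of_real R * (\<i> * cis (ap s))) = R * cos (\<theta> - ap s)"
      by (simp add: u_def inner_complex_def cos_diff algebra_simps)
    then have "u \<bullet> d = u \<bullet> w - u \<bullet> g s - R * cos (\<theta> - ap s)"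
      unfolding d_def c_def by (simp only: inner_diff_right inner_add_right)
    moreover have "u \<bullet> d = - cmod d"
      using False by (simp add: u sgn_div_norm power2_norm_eq_inner[symmetric] power2_eq_square)
    ultimately show ?thesis by (simp add: right_diff_distrib)
  qed (use R_pos in auto)
  then show "w \<in> cball (g s + of_real R * (\<i> * cis (ap s))) R"
    by (simp add: d_def c_def dist_norm norm_minus_commute)
qed

end

section \<open>Turan's pointwise estimate and the maximum norm\<close>

text \<open>The point \<open>z\<close> is on the boundary circle of the disc, and inversion at
  \<open>z\<close> sends the disc to a half-plane. Concretely, squaring
  \<open>cmod (y + of_real R * \<nu>) \<le> R\<close> for \<open>y = z - x\<close> and dividing by
  \<open>(cmod y)\<^sup>2\<close> gives the bound that each zero contributes to the logarithmic
  derivative.\<close>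

lemma turan_pointwise:
  fixes p :: "complex poly"
  assumes "0 < R" and \<nu>: "cmod \<nu> = 1"
    and zeros: "\<And>x. poly p x = 0 \<Longrightarrow> x \<in> cball (z + of_real R * \<nu>) R"
  shows "real (degree p) / (2 * R) * cmod (poly p z) \<le> cmod (poly (pderiv p) z)"
proof (cases "poly p z = 0")
  case False
  have "1 / (2 * R) \<le> Re (- \<nu> / (z - x))" if "poly p x = 0" for x
  proof -
    define y where "y = z - x"
    have "y \<noteq> 0" using that False by (auto simp: y_def)
    have "cmod (y + of_real R * \<nu>) \<le> R"
      using zeros[OF that] by (simp add: dist_norm y_def algebra_simps)
    then have "(cmod (y + of_real R * \<nu>))\<^sup>2 \<le> R\<^sup>2" using \<open>0 < R\<close> by (intro power_mono) auto
    moreover have "(Re \<nu>)\<^sup>2 + (Im \<nu>)\<^sup>2 = 1" using \<nu> cmod_power2[of \<nu>] by simp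
    then have "R\<^sup>2 * ((Re \<nu>)\<^sup>2 + (Im \<nu>)\<^sup>2) = R\<^sup>2" by simp
    moreover have "(cmod (y + of_real R * \<nu>))\<^sup>2
        = (cmod y)\<^sup>2 + 2 * R * (Re \<nu> * Re y + Im \<nu> * Im y) + R\<^sup>2 * ((Re \<nu>)\<^sup>2 + (Im \<nu>)\<^sup>2)"
      unfolding cmod_power2 by (simp add: power2_eq_square algebra_simps)
    ultimately have "(cmod y)\<^sup>2 \<le> - (2 * R * (Re \<nu> * Re y + Im \<nu> * Im y))" by linarith
    moreover have "Re (- \<nu> / y) = - (Re \<nu> * Re y + Im \<nu> * Im y) / (cmod y)\<^sup>2"
      by (simp add: Re_divide cmod_power2 diff_divide_distrib add_divide_distrib)
    moreover have "0 < (cmod y)\<^sup>2" using \<open>y \<noteq> 0\<close> by simp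
    ultimately have "1 / (2 * R) \<le> Re (- \<nu> / y)"
      using \<open>0 < R\<close> by (simp only:) (simp add: divide_simps, simp add: algebra_simps)
    then show ?thesis by (simp add: y_def)
  qed
  then have "real (degree p) * (1 / (2 * R)) \<le> Re (- \<nu> * poly (pderiv p) z / poly p z)"
    using False by (intro poly_logderiv_ge)
  also have "\<dots> \<le> cmod (- \<nu> * poly (pderiv p) z / poly p z)" by (rule complex_Re_le_cmod)
  also have "\<dots> = cmod (poly (pderiv p) z) / cmod (poly p z)" using \<nu> by (simp add: norm_mult norm_divide)
  finally show ?thesis using False by (simp add: field_simps)
qed auto

lemma cmod_poly_le_max_norm:
  assumes "compact K" "z \<in> K"
  shows "cmod (poly q z) \<le> max_norm K q"
proof -
  have "compact ((\<lambda>z. cmod (poly q z)) ` K)"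
    by (intro compact_continuous_image continuous_intros assms(1))
  then have "bdd_above ((\<lambda>z. cmod (poly q z)) ` K)"
    by (rule bounded_imp_bdd_above[OF compact_imp_bounded])
  then show ?thesis unfolding max_norm_def by (rule cSUP_upper[OF assms(2)])
qed

text \<open>By the maximum modulus principle. The rolling disc is available only at boundary points,
  so the maximum has to be located there.\<close>

lemma max_norm_attained_on_frontier:
  assumes "compact K" "frontier K \<noteq> {}"
  obtains z where "z \<in> frontier K" "max_norm K q = cmod (poly q z)"
proof -
  have "\<exists>z\<in>frontier K. \<forall>y\<in>frontier K. cmod (poly q y) \<le> cmod (poly q z)"
    by (intro continuous_attains_sup continuous_intros compact_frontier assms(1)) (rule assms(2))
  then obtain z where z: "z \<in> frontier K" "\<And>y. y \<in> frontier K \<Longrightarrow> cmod (poly q y) \<le> cmod (poly q z)"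
    by blast
  have zK: "z \<in> K" using z(1) assms(1) compact_imp_closed frontier_subset_closed by blast
  have "max_norm K q \<le> cmod (poly q z)" unfolding max_norm_def
  proof (rule cSUP_least)
    fix y assume y: "y \<in> K"
    show "cmod (poly q y) \<le> cmod (poly q z)"
    proof (rule maximum_modulus_frontier[of "poly q" K])
      show "poly q holomorphic_on interior K" by (intro holomorphic_intros)
      show "continuous_on (closure K) (poly q)" by (intro continuous_intros)
    qed (use assms(1) compact_imp_bounded y z(2) in blast)+
  qed (use zK in auto)
  then have "max_norm K q = cmod (poly q z)"
    by (rule antisym[OF _ cmod_poly_le_max_norm[OF assms(1) zK]])
  then show ?thesis by (rule that[OF z(1)])
qed

section \<open>Tangent angle functions and their growth\<close>

lemma dist_le_curve_length:
  assumes "s \<le> t"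
  shows "ereal (dist (g s) (g t)) \<le> curve_length g s t"
  unfolding curve_length_def using assms by (intro SUP_upper2[of "[s, t]"]) auto

lemma mono_right_limit_le:
  fixes f :: "real \<Rightarrow> real"
  assumes "mono f" "(f \<longlongrightarrow> l) (at_right s)" "s < m"
  shows "l \<le> f m"
proof (rule tendsto_upperbound[OF assms(2)])
  show "eventually (\<lambda>t. f t \<le> f m) (at_right s)"
    using eventually_at_right_real[OF assms(3)]
    by (rule eventually_mono) (use assms(1) in \<open>simp add: mono_def\<close>)
qed simp

lemma mono_left_limit_ge:
  fixes f :: "real \<Rightarrow> real"
  assumes "mono f" "(f \<longlongrightarrow> l) (at_left s)" "m < s"
  shows "f m \<le> l"
proof (rule tendsto_lowerbound[OF assms(2)])
  show "eventually (\<lambda>t. f m \<le> f t) (at_left s)"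
    using eventually_at_left_real[OF assms(3)]
    by (rule eventually_mono) (use assms(1) in \<open>simp add: mono_def\<close>)
qed simp

text \<open>Both sides are one-sided limits of the same monotone \<open>f\<close>, so a value of
  \<open>f\<close> at a point between \<open>s\<close> and \<open>t\<close> separates them.\<close>

lemma tangent_angle_functions_cross:
  assumes "tangent_angle_functions K a g am ap" "s < t"
  shows "ap s \<le> am t"
proof -
  obtain f where f: "mono f" "\<And>s. (f \<longlongrightarrow> am s) (at_left s)" "\<And>s. (f \<longlongrightarrow> ap s) (at_right s)"
    using assms(1) unfolding tangent_angle_functions_def by (elim conjE exE) auto
  obtain m where m: "s < m" "m < t" using dense[OF assms(2)] by blast
  have "ap s \<le> f m" by (rule mono_right_limit_le[OF f(1,3) m(1)])
  also have "f m \<le> am t" by (rule mono_left_limit_ge[OF f(1,2) m(2)])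
  finally show ?thesis .
qed

lemma tangent_angle_functions_right_continuous:
  assumes "tangent_angle_functions K a g am ap"
  shows "(ap \<longlongrightarrow> ap s) (at_right s)"
proof -
  obtain f where f: "mono f" "\<And>s. (f \<longlongrightarrow> ap s) (at_right s)"
    using assms unfolding tangent_angle_functions_def by (elim conjE exE) auto
  have m: "mono ap" using assms unfolding tangent_angle_functions_def by (elim conjE)
  show ?thesis
  proof (rule order_tendstoI)
    fix y assume "y < ap s"
    have "y < ap t" if "s < t" for t using \<open>y < ap s\<close> monoD[OF m, of s t] that by linarith
    then show "eventually (\<lambda>t. y < ap t) (at_right s)"
      by (rule eventually_mono[OF eventually_at_right_less])
  next
    fix y assume "ap s < y"
    then have "eventually (\<lambda>t. f t < y) (at_right s)" by (rule order_tendstoD[OF f(2)])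
    then obtain b where b: "s < b" "\<And>t. s < t \<Longrightarrow> t < b \<Longrightarrow> f t < y"
      unfolding eventually_at_right[OF less_add_one] by blast
    \<comment> \<open>The bound on \<open>f\<close> passes to its right limit \<open>ap t\<close>
      through a point \<open>m\<close> still to the left of \<open>b\<close>.\<close>
    have "ap t < y" if t: "s < t" "t < b" for t
    proof -
      obtain m where m: "t < m" "m < b" using dense[OF t(2)] by blast
      have "ap t \<le> f m" by (rule mono_right_limit_le[OF f m(1)])
      also have "f m < y" using b t m by auto
      finally show ?thesis .
    qed
    then show "eventually (\<lambda>t. ap t < y) (at_right s)"
      unfolding eventually_at_right[OF b(1)] using b(1) by blast
  qed
qed

lemma mono_tangent_angle:
  assumes "tangent_angle_functions K a g am ap"
  shows "mono (tangent_angle am ap)"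
  using assms
  by (auto simp: tangent_angle_functions_def tangent_angle_def mono_def intro!: divide_right_mono add_mono)

text \<open>Passes from the mean angle to \<open>ap\<close>. At \<open>x\<close> the mean angle may
  lie below \<open>ap x\<close>, so growth is measured from \<open>t > x\<close>, where it is at
  least \<open>am t\<close> and hence at least \<open>ap x\<close>; then \<open>t\<close> tends to
  \<open>x\<close>.\<close>

lemma right_tangent_angle_growth:
  assumes taf: "tangent_angle_functions K a g am ap"
    and ae: "AE t\<in>{0..a} in lebesgue.
      tangent_angle am ap differentiable (at t) \<and> \<kappa> \<le> curvature am ap t"
    and "0 \<le> \<kappa>" "0 \<le> x" "x \<le> y" "y \<le> a"
  shows "\<kappa> * (y - x) \<le> ap y - ap x"
proof (cases "x = y")
  case False
  then have xy: "x < y" using \<open>x \<le> y\<close> by simp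
  let ?f = "tangent_angle am ap"
  have mono: "mono ?f" by (rule mono_tangent_angle[OF taf])
  have am_ap: "am s \<le> ap s" for s using taf by (auto simp: tangent_angle_functions_def)
  have "eventually (\<lambda>t. \<kappa> * (y - t) \<le> ap y - ap x) (at_right x)"
    using eventually_at_right_real[OF xy]
  proof eventually_elim
    case (elim t)
    have "AE z\<in>{t..y} in lebesgue. ?f differentiable (at z) \<and> \<kappa> \<le> deriv ?f z"
      using ae by (rule AE_mp) (use assms elim in \<open>auto simp: curvature_def intro!: AE_I2\<close>)
    then have "\<kappa> * (y - t) \<le> ?f y - ?f t"
      using elim \<open>0 \<le> \<kappa>\<close> by (intro mono_growth_of_AE_deriv mono) auto
    moreover have "?f y \<le> ap y" using am_ap[of y] by (simp add: tangent_angle_def)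
    moreover have "ap x \<le> ?f t"
      using tangent_angle_functions_cross[OF taf, of x t] am_ap[of t] elim by (simp add: tangent_angle_def)
    ultimately show ?case by linarith
  qed
  moreover have "((\<lambda>t. \<kappa> * (y - t)) \<longlongrightarrow> \<kappa> * (y - x)) (at_right x)"
    by (intro tendsto_intros)
  ultimately show ?thesis by (intro tendsto_upperbound) auto
qed auto

lemma curvature_ge_of_radius_le:
  assumes taf: "tangent_angle_functions K a g am ap" and "0 < \<kappa>"
    and diff: "tangent_angle am ap differentiable (at t)"
    and rad: "radius_of_curvature am ap t \<le> ereal (1 / \<kappa>)"
  shows "\<kappa> \<le> curvature am ap t"
proof -
  let ?c = "curvature am ap t"
  have "mono (tangent_angle am ap)" by (rule mono_tangent_angle[OF taf])
  moreover have "(tangent_angle am ap has_real_derivative ?c) (at t)"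
    using diff by (simp add: curvature_def DERIV_deriv_iff_real_differentiable)
  \<comment> \<open>A negative curvature would have a negative radius and satisfy the bound;
    monotonicity of the angle rules it out. Zero is excluded next because its radius is
    infinite.\<close>
  ultimately have "0 \<le> ?c"
    using mono_on_imp_deriv_nonneg[of UNIV] by auto
  moreover have "?c \<noteq> 0" using rad by (auto simp: radius_of_curvature_def divide_ereal_def)
  ultimately have "0 < ?c" by simp
  moreover from this have "1 / ?c \<le> 1 / \<kappa>"
    using rad by (simp add: radius_of_curvature_def divide_ereal_def divide_inverse one_ereal_def)
  ultimately show ?thesis using \<open>0 < \<kappa>\<close> by (simp add: field_simps)
qed

text \<open>Subtracting the linear function of slope \<open>q / a\<close> makes \<open>f\<close>
  periodic, so the bound on \<open>{0..a}\<close> carries over to the period containing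
  \<open>s\<close>. Points slightly to the right of \<open>s\<close> remain in that period.\<close>

lemma right_growth_periodic:
  fixes f :: "real \<Rightarrow> real"
  assumes "0 < a" and per: "\<And>s. f (s + a) = f s + q"
    and G: "\<And>x y. 0 \<le> x \<Longrightarrow> x \<le> y \<Longrightarrow> y \<le> a \<Longrightarrow> k * (y - x) \<le> f y - f x"
  shows "eventually (\<lambda>t. k * (t - s) \<le> f t - f s) (at_right s)"
proof -
  interpret periodic_fun_simple "\<lambda>s. f s - q / a * s" a
    by standard (use \<open>0 < a\<close> per in \<open>simp add: field_simps\<close>)
  define m where "m = \<lfloor>s / a\<rfloor>"
  have "of_int m \<le> s / a" "s / a < of_int m + 1" unfolding m_def by linarith+
  then have s: "of_int m * a \<le> s" "s < of_int m * a + a"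
    using \<open>0 < a\<close> by (auto simp: field_simps)
  show ?thesis using eventually_at_right_real[OF s(2)]
  proof eventually_elim
    case (elim t)
    have shift: "f (x - of_int m * a) = f x - q * of_int m" for x
      using minus_of_int[of x m] \<open>0 < a\<close> by (simp add: right_diff_distrib)
    show ?case
      using G[of "s - of_int m * a" "t - of_int m * a"] s elim by (simp add: shift)
  qed
qed

theorem theorem2:
  fixes K :: "complex set" and a \<kappa> :: real and \<gamma> :: "real \<Rightarrow> complex"
    and \<alpha>m \<alpha>p :: "real \<Rightarrow> real" and n :: nat and p :: "complex poly"
  assumes "convex_domain K"
    and "arc_length_parametrization K a \<gamma>"
    and "tangent_angle_functions K a \<gamma> \<alpha>m \<alpha>p"
    and "\<kappa> > 0"
    and "(AE t\<in>{0..a} in lebesgue.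
            tangent_angle \<alpha>m \<alpha>p differentiable (at t) \<and> curvature \<alpha>m \<alpha>p t \<ge> \<kappa>)
       \<or> (AE t\<in>{0..a} in lebesgue.
            tangent_angle \<alpha>m \<alpha>p differentiable (at t) \<and>
            radius_of_curvature \<alpha>m \<alpha>p t \<le> ereal (1 / \<kappa>))
       \<or> (\<forall>x\<in>{0..a}. \<forall>y\<in>{0..a}. x \<le> y \<longrightarrow>
            \<alpha>p y - \<alpha>p x \<ge> \<kappa> * (y - x) \<and> \<alpha>m y - \<alpha>m x \<ge> \<kappa> * (y - x))
       \<or> (\<forall>s\<in>{0..a}. \<forall>t\<in>{0..a}.
            \<bar>\<alpha>p t - \<alpha>p s\<bar> \<ge> \<kappa> * \<bar>t - s\<bar> \<and> \<bar>\<alpha>m t - \<alpha>m s\<bar> \<ge> \<kappa> * \<bar>t - s\<bar>)"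
    and "n > 0"
    and "p \<in> polys_with_zeros_in n K"
  shows "max_norm K (pderiv p) \<ge> \<kappa> / 2 * real n * max_norm K p"
proof -
  have K: "compact K" using assms(1) by (simp add: convex_domain_def)
  have "0 < a" and per: "\<And>s. \<gamma> (s + a) = \<gamma> s" and front: "\<gamma> ` {0..a} = frontier K"
    and len: "\<And>s t. s \<le> t \<Longrightarrow> curve_length \<gamma> s t = ereal (t - s)"
    using assms(2) by (auto simp: arc_length_parametrization_def)
  note taf = assms(3)
  have mono: "mono \<alpha>p" and perp: "\<And>s. \<alpha>p (s + a) = \<alpha>p s + 2 * pi"
    using taf by (auto simp: tangent_angle_functions_def)
  have G: "\<kappa> * (y - x) \<le> \<alpha>p y - \<alpha>p x" if xy: "0 \<le> x" "x \<le> y" "y \<le> a" for x y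
    using assms(5)
  proof (elim disjE)
    assume ae: "AE t\<in>{0..a} in lebesgue.
      tangent_angle \<alpha>m \<alpha>p differentiable (at t) \<and> curvature \<alpha>m \<alpha>p t \<ge> \<kappa>"
    show ?thesis by (rule right_tangent_angle_growth[OF taf ae less_imp_le[OF assms(4)] xy])
  next
    assume "AE t\<in>{0..a} in lebesgue.
      tangent_angle \<alpha>m \<alpha>p differentiable (at t) \<and> radius_of_curvature \<alpha>m \<alpha>p t \<le> ereal (1 / \<kappa>)"
    then have ae: "AE t\<in>{0..a} in lebesgue.
      tangent_angle \<alpha>m \<alpha>p differentiable (at t) \<and> curvature \<alpha>m \<alpha>p t \<ge> \<kappa>"
      by (rule AE_mp) (auto intro!: AE_I2 curvature_ge_of_radius_le[OF taf assms(4)])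
    show ?thesis by (rule right_tangent_angle_growth[OF taf ae less_imp_le[OF assms(4)] xy])
  next
    assume "\<forall>x\<in>{0..a}. \<forall>y\<in>{0..a}. x \<le> y \<longrightarrow>
      \<alpha>p y - \<alpha>p x \<ge> \<kappa> * (y - x) \<and> \<alpha>m y - \<alpha>m x \<ge> \<kappa> * (y - x)"
    then show ?thesis using xy by auto
  next
    assume "\<forall>s\<in>{0..a}. \<forall>t\<in>{0..a}.
      \<bar>\<alpha>p t - \<alpha>p s\<bar> \<ge> \<kappa> * \<bar>t - s\<bar> \<and> \<bar>\<alpha>m t - \<alpha>m s\<bar> \<ge> \<kappa> * \<bar>t - s\<bar>"
    moreover have "x \<in> {0..a}" "y \<in> {0..a}" using xy by auto
    \<comment> \<open>Monotonicity of \<open>\<alpha>p\<close> removes the absolute values.\<close>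
    ultimately have "\<kappa> * \<bar>y - x\<bar> \<le> \<bar>\<alpha>p y - \<alpha>p x\<bar>" by blast
    then show ?thesis using xy monoD[OF mono xy(2)] by simp
  qed
  interpret curved_boundary \<gamma> a "1 / \<kappa>" \<alpha>m \<alpha>p
  proof
    show "0 < 1 / \<kappa>" using assms(4) by simp
    show "cmod (\<gamma> t - \<gamma> s) \<le> t - s" if "s \<le> t" for s t
      using dist_le_curve_length[OF that, of \<gamma>] len[OF that] by (simp add: dist_norm norm_minus_commute)
    show "eventually (\<lambda>t. t - s \<le> 1 / \<kappa> * (\<alpha>p t - \<alpha>p s)) (at_right s)" for s
      using right_growth_periodic[OF \<open>0 < a\<close> perp G, of s] assms(4)
      by (simp add: field_simps)
    show "\<alpha>p s \<le> \<alpha>m t" if "s < t" for s t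
      using tangent_angle_functions_cross[OF taf that] .
    show "(\<alpha>p \<longlongrightarrow> \<alpha>p s) (at_right s)" for s
      using tangent_angle_functions_right_continuous[OF taf] .
  qed (use taf \<open>0 < a\<close> per perp in \<open>auto simp: tangent_angle_functions_def\<close>)
  have "range \<gamma> \<subseteq> \<gamma> ` {0..a}"
  proof clarify
    fix x
    obtain t where "0 \<le> t" "t < 0 + a" "\<gamma> t = \<gamma> x" using representative[of 0 x] by blast
    then show "\<gamma> x \<in> \<gamma> ` {0..a}" by (intro rev_image_eqI[of t]) auto
  qed
  moreover have "\<gamma> ` {0..a} \<subseteq> range \<gamma>" by blast
  ultimately have rg: "frontier K = range \<gamma>" using front by simp
  then obtain z where z: "z \<in> frontier K" "max_norm K p = cmod (poly p z)"
    using max_norm_attained_on_frontier[OF K, of p] by auto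
  then obtain s where s: "z = \<gamma> s" using rg by auto
  have deg: "degree p = n" and zeros: "\<And>x. poly p x = 0 \<Longrightarrow> x \<in> K"
    using assms(7) by (auto simp: polys_with_zeros_in_def)
  \<comment> \<open>The disc of radius \<open>1 / \<kappa>\<close> touching the curve at the maximum
    point \<open>z\<close> contains \<open>K\<close> and hence all zeros of
    \<open>p\<close>.\<close>
  have "real (degree p) / (2 * (1 / \<kappa>)) * cmod (poly p z) \<le> cmod (poly (pderiv p) z)"
  proof (rule turan_pointwise)
    show "x \<in> cball (z + of_real (1 / \<kappa>) * (\<i> * cis (\<alpha>p s))) (1 / \<kappa>)" if "poly p x = 0" for x
      using subset_rolling_disc[OF K rg, of s] zeros[OF that] unfolding s by blast
  qed (use R_pos norm_ii_cis in auto)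
  also have "\<dots> \<le> max_norm K (pderiv p)"
    using z(1) K compact_imp_closed frontier_subset_closed by (intro cmod_poly_le_max_norm) blast+
  finally show ?thesis by (simp add: z(2) deg field_simps)
qed

end
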